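(* The covering type of the real projective plane $\mathbb{RP}^2$ is $6$, i.e. $ct(\mathbb{RP}^2)=6$.
   Context: A good (open) cover of a topological space $X$ is a family of contractible open subspaces $U_i$ covering $X$ such that every nonempty intersection $U_{i_1}\cap\dots\cap U_{i_n}$ is contractible. The strict covering type of $X$ is the minimum number of elements in a good open cover of $X$. The covering type $ct(X)$ is the minimum of the strict covering types of spaces $X'$ homotopy equivalent to $X$. *)

theory Defs
  imports "HOL-Analysis.Analysis" "HOL-Library.Extended_Nat"
begin

text \<open>
  The library predicate \<^const>\<open>contractible_space\<close> holds of the empty space; the usual convention,
  adopted here, is that a contractible space is nonempty, so nonemptiness is required separately.
\<close>

definition good_cover :: "'a topology \<Rightarrow> 'a set set \<Rightarrow> bool" where
  "good_cover X \<U> \<longleftrightarrow>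
     (\<forall>U\<in>\<U>. openin X U \<and> U \<noteq> {} \<and> contractible_space (subtopology X U)) \<and>
     \<Union>\<U> = topspace X \<and>
     (\<forall>\<F>. \<F> \<subseteq> \<U> \<and> finite \<F> \<and> \<F> \<noteq> {} \<and> \<Inter>\<F> \<noteq> {} \<longrightarrow>
          contractible_space (subtopology X (\<Inter>\<F>)))"

text \<open>
  In \<^typ>\<open>enat\<close> the infimum of a nonempty set is its least element, and the infimum of the empty
  set is \<open>\<infinity>\<close>.  So a finite value is always an attained minimum, and \<open>\<infinity>\<close> means that there is no
  finite good cover.
\<close>

definition strict_covering_type :: "'a topology \<Rightarrow> enat" where
  "strict_covering_type X = Inf {enat (card \<U>) | \<U>. finite \<U> \<and> good_cover X \<U>}"

text \<open>
  A definition cannot range over spaces of all types at once, so the type \<open>'b\<close> of the points of the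
  competing spaces \<open>X'\<close> is a parameter.
\<close>

definition covering_type :: "'b itself \<Rightarrow> 'a topology \<Rightarrow> enat" where
  "covering_type (_ :: 'b itself) X =
     Inf {strict_covering_type X' | X' :: 'b topology. X' homotopy_equivalent_space X}"

definition antipodal_class :: "real^3 \<Rightarrow> (real^3) set" where
  "antipodal_class x = {x, - x}"

text \<open>The quotient of the unit sphere of \<open>\<real>\<^sup>3\<close> by the antipodal map, with the quotient topology.\<close>

definition real_projective_plane :: "(real^3) set topology" where
  "real_projective_plane = topology (\<lambda>V. V \<subseteq> antipodal_class ` sphere 0 1 \<and>
     openin (top_of_set (sphere 0 1)) {x \<in> sphere 0 1. antipodal_class x \<in> V})"

lemma openin_real_projective_plane:
  "openin real_projective_plane V \<longleftrightarrow> V \<subseteq> antipodal_class ` sphere 0 1 \<and>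
     openin (top_of_set (sphere 0 1)) {x \<in> sphere 0 1. antipodal_class x \<in> V}"
proof -
  let ?O = "\<lambda>V. V \<subseteq> antipodal_class ` sphere 0 1 \<and>
     openin (top_of_set (sphere 0 1)) {x \<in> sphere 0 1. antipodal_class x \<in> V}"
  have "?O (S \<inter> T)" if "?O S" "?O T" for S T
  proof -
    have "{x \<in> sphere 0 1. antipodal_class x \<in> S \<inter> T} =
        {x \<in> sphere 0 1. antipodal_class x \<in> S} \<inter> {x \<in> sphere 0 1. antipodal_class x \<in> T}"
      by blast
    then show ?thesis
      using that by (metis (no_types, lifting) inf.coboundedI1 openin_Int)
  qed
  moreover have "?O (\<Union>\<K>)" if "\<forall>K\<in>\<K>. ?O K" for \<K>
  proof -
    have "{x \<in> sphere 0 1. antipodal_class x \<in> \<Union>\<K>} =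
        (\<Union>K\<in>\<K>. {x \<in> sphere 0 1. antipodal_class x \<in> K})"
      by blast
    moreover have "openin (top_of_set (sphere 0 1))
        (\<Union>K\<in>\<K>. {x \<in> sphere 0 1. antipodal_class x \<in> K})"
      using that by blast
    ultimately show ?thesis
      using that by (simp add: Union_least)
  qed
  ultimately have "istopology ?O"
    unfolding istopology_def by blast
  then show ?thesis
    unfolding real_projective_plane_def by (simp add: topology_inverse')
qed

lemma quotient_map_antipodal_class:
  "quotient_map (top_of_set (sphere 0 1)) real_projective_plane antipodal_class"
proof -
  have "{x \<in> sphere 0 1. antipodal_class x \<in> antipodal_class ` sphere 0 1} = sphere 0 1"
    by blast
  then have "openin real_projective_plane (antipodal_class ` sphere 0 1)"
    unfolding openin_real_projective_plane by simp
  then have "topspace real_projective_plane = antipodal_class ` sphere 0 1"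
    by (metis openin_real_projective_plane openin_subset openin_topspace subset_antisym)
  then show ?thesis
    by (simp add: quotient_map_def openin_real_projective_plane)
qed

lemma antipodal_class_eq_iff: "antipodal_class x = antipodal_class y \<longleftrightarrow> x = y \<or> x = - y"
  by (auto simp: antipodal_class_def doubleton_eq_iff)

end

theory Submission
  imports Defs
begin

text \<open>
  Lower bound: for a map \<open>f : Y \<rightarrow> \<real>P\<^sup>2\<close>, being liftable to \<open>S\<^sup>2\<close> is a homotopy invariant
  property, so it holds on contractible \<open>Y\<close>, and two open sets on which \<open>f\<close> lifts and whose
  intersection is connected may be replaced by their union.  If \<open>f : X \<rightarrow> \<real>P\<^sup>2\<close> is a homotopy
  equivalence, an open cover of \<open>X\<close> by sets on which \<open>f\<close> lifts and no three of which meet would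
  yield an odd nonvanishing map \<open>S\<^sup>2 \<rightarrow> \<complex>\<close>, which does not exist.  Hence a good cover of \<open>X\<close>
  has three members with a common point.  Their union is a set on which \<open>f\<close> lifts, and if at most
  two members were left, the union of these would be another one.  These two sets would be a cover
  of the forbidden kind.

  Upper bound: the six pairs of opposite vertices of an icosahedron are the centres of six circular
  caps of \<open>\<real>P\<^sup>2\<close> which can be made large enough to cover it but so small that the lifts to the
  sphere of any intersecting family can be chosen consistently.  An intersection of caps is then
  geodesically convex.
\<close>

section \<open>Local sections of the double cover of the projective plane by the sphere\<close>

abbreviation S2 :: "(real^3) set" where
  "S2 \<equiv> sphere 0 1"

lemma topspace_real_projective_plane: "topspace real_projective_plane = antipodal_class ` S2"
  using quotient_imp_surjective_map[OF quotient_map_antipodal_class] by simp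

lemma continuous_map_antipodal_class:
  "continuous_map (top_of_set S2) real_projective_plane antipodal_class"
  using quotient_map_antipodal_class by (rule quotient_imp_continuous_map)

lemma antipodal_class_uminus [simp]: "antipodal_class (- x) = antipodal_class x"
  by (simp add: antipodal_class_eq_iff)

text \<open>For a unit vector \<open>x\<close> this is the orthogonal projection of \<open>v\<close>
  onto the line through \<open>x\<close>. It is even in \<open>x\<close>, so the choice of
  representative does not matter and it descends to the quotient. Where it is nonzero, its
  normalisation is a continuous section of \<open>antipodal_class\<close>, choosing the
  representative in the open hemisphere around \<open>v\<close>.\<close>

definition line_part :: "real^3 \<Rightarrow> (real^3) set \<Rightarrow> real^3" where
  "line_part v c = (let x = (SOME x. x \<in> c) in (x \<bullet> v) *\<^sub>R x)"

lemma line_part_antipodal_class [simp]: "line_part v (antipodal_class x) = (x \<bullet> v) *\<^sub>R x"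
proof -
  have "(SOME y. y \<in> antipodal_class x) \<in> antipodal_class x"
    by (rule someI[of _ x]) (simp add: antipodal_class_def)
  then show ?thesis
    unfolding line_part_def Let_def by (auto simp: antipodal_class_def)
qed

lemma continuous_map_line_part: "continuous_map real_projective_plane euclidean (line_part v)"
proof (rule continuous_compose_quotient_map[OF quotient_map_antipodal_class])
  have "continuous_on S2 (\<lambda>x. (x \<bullet> v) *\<^sub>R x)"
    by (intro continuous_intros)
  then show "continuous_map (top_of_set S2) euclidean (line_part v \<circ> antipodal_class)"
    by (simp add: o_def)
qed

lemma sgn_line_part:
  "x \<in> S2 \<Longrightarrow> sgn (line_part v (antipodal_class x)) = sgn (x \<bullet> v) *\<^sub>R x"
  by (simp add: sgn_scaleR sgn_div_norm)

lemma continuous_map_continuous_on_compose: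
  assumes "continuous_map X (top_of_set S) f" "continuous_on S g"
  shows "continuous_map X euclidean (\<lambda>x. g (f x))"
  using continuous_map_compose[OF assms(1), of euclidean g] assms(2) by (simp add: o_def)

lemma sgn_eq_on_connected:
  fixes A :: "real set"
  assumes A: "connected A" "0 \<notin> A" and ab: "a \<in> A" "b \<in> A"
  shows "sgn a = sgn b"
proof -
  have "\<not> (x < 0 \<and> 0 < y)" if "x \<in> A" "y \<in> A" for x y
    using connected_contains_Icc[OF A(1) that] A(2) by (auto simp: subset_iff)
  then show ?thesis
    using A(2) ab by (metis linorder_neqE_linordered_idom sgn_neg sgn_pos)
qed

section \<open>Lifting paths and homotopies to the sphere\<close>

text \<open>By bisection: lifts over adjacent intervals concatenate, and over a short interval
  around any point a normalised \<open>line_part\<close> supplies a lift.\<close>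

lemma path_lift_real_projective_plane:
  assumes p: "continuous_map (top_of_set {0..1::real}) real_projective_plane p"
    and x: "x \<in> S2" "antipodal_class x = p 0"
  obtains l where "continuous_on {0..1} l" "l 0 = x"
    "\<And>t. t \<in> {0..1} \<Longrightarrow> l t \<in> S2 \<and> antipodal_class (l t) = p t"
proof -
  \<comment> \<open>All starting points over \<open>p a\<close> are allowed, so that a lift over the
    next interval can begin where the previous one ended. Intervals not inside [0, 1] satisfy
    \<open>P\<close> vacuously.\<close>
  define P where "P a b \<longleftrightarrow> (0 \<le> a \<and> b \<le> 1 \<longrightarrow> (\<forall>x\<in>S2. antipodal_class x = p a \<longrightarrow>
     (\<exists>l. continuous_on {a..b} l \<and> l a = x \<and> (\<forall>t\<in>{a..b}. l t \<in> S2 \<and> antipodal_class (l t) = p t))))"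
    for a b
  have "P 0 1"
  proof (rule Bolzano)
    fix a b c :: real
    assume P: "P a b" "P b c" and le: "a \<le> b" "b \<le> c"
    show "P a c"
      unfolding P_def
    proof (intro impI ballI)
      fix x assume ac: "0 \<le> a \<and> c \<le> 1" and x: "x \<in> S2" "antipodal_class x = p a"
      obtain l where l: "continuous_on {a..b} l" "l a = x"
        "\<forall>t\<in>{a..b}. l t \<in> S2 \<and> antipodal_class (l t) = p t"
        using P(1) x ac le unfolding P_def by (meson order_trans)
      obtain m where m: "continuous_on {b..c} m" "m b = l b"
        "\<forall>t\<in>{b..c}. m t \<in> S2 \<and> antipodal_class (m t) = p t"
        using P(2) l(3) ac le unfolding P_def by (meson atLeastAtMost_iff order_refl order_trans)
      have "continuous_on ({a..b} \<union> {b..c}) (\<lambda>t. if t \<le> b then l t else m t)"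
        using l m by (intro continuous_on_cases) auto
      then have "continuous_on {a..c} (\<lambda>t. if t \<le> b then l t else m t)"
        using le by (simp add: ivl_disj_un_two_touch)
      then show "\<exists>l. continuous_on {a..c} l \<and> l a = x \<and>
          (\<forall>t\<in>{a..c}. l t \<in> S2 \<and> antipodal_class (l t) = p t)"
        using l m le by (intro exI[of _ "\<lambda>t. if t \<le> b then l t else m t"]) auto
    qed
  next
    fix x :: real assume x: "0 \<le> x" "x \<le> 1"
    then have "p x \<in> topspace real_projective_plane"
      using p by (auto simp: continuous_map_def)
    then obtain v where v: "v \<in> S2" "antipodal_class v = p x"
      unfolding topspace_real_projective_plane by (metis imageE)
    have cont: "continuous_on {0..1} (\<lambda>t. line_part v (p t))"
      using continuous_map_compose[OF p continuous_map_line_part[of v]] by (simp add: o_def)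
    have "line_part v (p x) \<noteq> 0"
      using v by (metis line_part_antipodal_class inner_eq_zero_iff norm_zero scaleR_eq_0_iff
          zero_neq_one mem_sphere_0)
    then obtain d where d: "d > 0" "\<And>t. t \<in> {0..1} \<Longrightarrow> dist x t < d \<Longrightarrow> line_part v (p t) \<noteq> 0"
      using continuous_on_avoid[OF cont, of x 0] x by auto
    show "\<exists>d>0. \<forall>a b. a \<le> x \<and> x \<le> b \<and> b - a < d \<longrightarrow> P a b"
    proof (intro exI[of _ d] conjI d allI impI)
      fix a b assume ab: "a \<le> x \<and> x \<le> b \<and> b - a < d"
      show "P a b"
        unfolding P_def
      proof (intro impI ballI)
        fix z assume ab1: "0 \<le> a \<and> b \<le> 1" and z: "z \<in> S2" "antipodal_class z = p a"
        have nz: "line_part v (p t) \<noteq> 0" if "t \<in> {a..b}" for t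
          using that ab ab1 by (intro d) (auto simp: dist_real_def)
        \<comment> \<open>The local section may begin at \<open>- z\<close>; the constant sign in
          front makes it begin at \<open>z\<close>.\<close>
        define l where "l t = sgn (z \<bullet> v) *\<^sub>R sgn (line_part v (p t))" for t
        have "l a = (sgn (z \<bullet> v) * sgn (z \<bullet> v)) *\<^sub>R z"
          unfolding l_def using sgn_line_part[OF z(1), of v] z by simp
        moreover have zv: "z \<bullet> v \<noteq> 0"
          using nz[of a] ab z by (metis atLeastAtMost_iff line_part_antipodal_class order_refl order_trans scaleR_zero_left)
        ultimately have "l a = z"
          by (simp add: sgn_if split: if_splits)
        moreover have "continuous_on {a..b} l"
          unfolding l_def using nz ab1
          by (intro continuous_intros continuous_on_subset[OF cont]) auto
        moreover have "l t \<in> S2 \<and> antipodal_class (l t) = p t" if t: "t \<in> {a..b}" for t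
        proof -
          have "p t \<in> topspace real_projective_plane"
            using p t ab1 by (auto simp: continuous_map_def)
          then obtain w where w: "w \<in> S2" "p t = antipodal_class w"
            unfolding topspace_real_projective_plane by (metis imageE)
          then have "w \<bullet> v \<noteq> 0"
            using nz[OF t] by auto
          then have "l t = w \<or> l t = - w"
            unfolding l_def w(2) sgn_line_part[OF w(1)] using zv by (auto simp: sgn_if)
          then show ?thesis
            using w by (metis antipodal_class_uminus norm_minus_cancel mem_sphere_0)
        qed
        ultimately show "\<exists>l. continuous_on {a..b} l \<and> l a = z \<and>
            (\<forall>t\<in>{a..b}. l t \<in> S2 \<and> antipodal_class (l t) = p t)"
          by blast
      qed
    qed
  qed simp
  then show ?thesis
    unfolding P_def using that x by auto
qed

definition liftable :: "'a topology \<Rightarrow> ('a \<Rightarrow> (real^3) set) \<Rightarrow> bool" where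
  "liftable Y f \<longleftrightarrow> (\<exists>s. continuous_map Y (top_of_set S2) s \<and>
     (\<forall>y\<in>topspace Y. antipodal_class (s y) = f y))"

text \<open>Each path \<open>H (t, y)\<close> in \<open>t\<close> is lifted from the starting point
  \<open>s y\<close>, and the end points of the lifts form a lift of \<open>g\<close>. The work lies
  in their continuity in \<open>y\<close>, which is carried from time 0 to time 1 by a second
  bisection.\<close>

lemma liftable_homotopic:
  assumes hom: "homotopic_with (\<lambda>_. True) Y real_projective_plane f g" and f: "liftable Y f"
  shows "liftable Y g"
proof -
  obtain H where H: "continuous_map (prod_topology (top_of_set {0..1}) Y) real_projective_plane H"
    and H0: "\<And>y. y \<in> topspace Y \<Longrightarrow> H (0::real, y) = f y"
    and H1: "\<And>y. y \<in> topspace Y \<Longrightarrow> H (1, y) = g y"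
    using hom by (subst (asm) homotopic_with) auto
  obtain s where s: "continuous_map Y (top_of_set S2) s"
    "\<And>y. y \<in> topspace Y \<Longrightarrow> antipodal_class (s y) = f y"
    using f unfolding liftable_def by blast
  have "\<exists>l. continuous_on {0..1} l \<and> l 0 = s y \<and>
      (\<forall>t\<in>{0..1}. l t \<in> S2 \<and> antipodal_class (l t) = H (t, y))" if y: "y \<in> topspace Y" for y
  proof -
    have "continuous_map (top_of_set {0..1}) (prod_topology (top_of_set {0..1}) Y) (\<lambda>t. (t, y))"
      using y by (intro continuous_map_pairedI) auto
    then have "continuous_map (top_of_set {0..1}) real_projective_plane (\<lambda>t. H (t, y))"
      using continuous_map_compose[OF _ H] by (simp add: o_def)
    moreover have "s y \<in> S2"
      using s(1) y by (auto simp: continuous_map_def)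
    moreover have "antipodal_class (s y) = H (0, y)"
      using s(2) H0 y by simp
    ultimately obtain l where "continuous_on {0..1} l" "l 0 = s y"
      "\<And>t. t \<in> {0..1} \<Longrightarrow> l t \<in> S2 \<and> antipodal_class (l t) = H (t, y)"
      by (rule path_lift_real_projective_plane) blast
    then show ?thesis
      by blast
  qed
  then obtain L where L: "\<And>y. y \<in> topspace Y \<Longrightarrow> continuous_on {0..1} (L y)"
    "\<And>y. y \<in> topspace Y \<Longrightarrow> L y 0 = s y"
    "\<And>y t. y \<in> topspace Y \<Longrightarrow> t \<in> {0..1} \<Longrightarrow> L y t \<in> S2 \<and> antipodal_class (L y t) = H (t, y)"
    by metis
  \<comment> \<open>Continuity near \<open>y\<close> at a fixed time \<open>t\<close>. The
    neighbourhood may depend on \<open>t\<close>, which suffices because only finitely many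
    bisection steps shrink it.\<close>
  define C where "C y t \<longleftrightarrow> (\<exists>N. openin Y N \<and> y \<in> N \<and>
      continuous_map (subtopology Y N) euclidean (\<lambda>y'. L y' t))" for y t
  have C1: "C y 1" if y: "y \<in> topspace Y" for y
  proof -
    define P where "P a b \<longleftrightarrow> (0 \<le> a \<and> b \<le> 1 \<longrightarrow> C y a \<longrightarrow> C y b)" for a b :: real
    have "P 0 1"
    proof (rule Bolzano)
      show "P a c" if "P a b" "P b c" "a \<le> b" "b \<le> c" for a b c
        using that by (auto simp: P_def)
    next
      fix x :: real assume x: "0 \<le> x" "x \<le> 1"
      define v where "v = L y x"
      let ?X = "prod_topology (top_of_set {0..1::real}) Y"
      have cont: "continuous_map ?X euclidean (\<lambda>z. line_part v (H z))"
        using continuous_map_compose[OF H continuous_map_line_part[of v]] by (simp add: o_def)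
      have op: "openin ?X {z \<in> topspace ?X. line_part v (H z) \<in> - {0}}"
        by (rule openin_continuous_map_preimage[OF cont]) auto
      have "v \<in> S2" "H (x, y) = antipodal_class v"
        using L(3)[OF y, of x] x by (auto simp: v_def)
      then have "(x, y) \<in> {z \<in> topspace ?X. line_part v (H z) \<in> - {0}}"
        using x y by auto
      \<comment> \<open>On the box \<open>T \<times> N\<close> one local section, the one determined
        by \<open>v\<close>, serves all nearby paths at once.\<close>
      then obtain T N where T: "openin (top_of_set {0..1}) T" "x \<in> T" and N: "openin Y N" "y \<in> N"
        and TN: "T \<times> N \<subseteq> {z \<in> topspace ?X. line_part v (H z) \<in> - {0}}"
        using op unfolding openin_prod_topology_alt by meson
      obtain d where d: "d > 0" "ball x d \<inter> {0..1} \<subseteq> T"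
        using T by (meson openin_contains_ball)
      show "\<exists>d>0. \<forall>a b. a \<le> x \<and> x \<le> b \<and> b - a < d \<longrightarrow> P a b"
      proof (intro exI[of _ d] conjI d allI impI)
        fix a b assume ab: "a \<le> x \<and> x \<le> b \<and> b - a < d"
        show "P a b"
          unfolding P_def
        proof (intro impI)
          assume ab1: "0 \<le> a \<and> b \<le> 1" and "C y a"
          then obtain N' where N': "openin Y N'" "y \<in> N'"
            "continuous_map (subtopology Y N') euclidean (\<lambda>y'. L y' a)"
            unfolding C_def by blast
          let ?M = "N \<inter> N'"
          have MY: "?M \<subseteq> topspace Y"
            using N by (meson inf.coboundedI1 openin_subset)
          have abT: "{a..b} \<subseteq> T"
            using ab ab1 d by (force simp: dist_real_def)
          have nz: "line_part v (H (t, y')) \<noteq> 0" if "t \<in> {a..b}" "y' \<in> ?M" for t y'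
            using that abT TN by blast
          have nz': "L y' t \<bullet> v \<noteq> 0" if "t \<in> {a..b}" "y' \<in> ?M" for t y'
          proof -
            have "antipodal_class (L y' t) = H (t, y')"
              using L(3)[of y' t] that MY ab1 by auto
            then show ?thesis
              using nz[OF that] by (metis line_part_antipodal_class scaleR_zero_left)
          qed
          \<comment> \<open>Along the lifted path the inner product with \<open>v\<close> is
            continuous in time and never zero, so its sign at time \<open>b\<close> is the one at
            time \<open>a\<close>. Hence \<open>L y' b\<close> is expressed by \<open>L y' a\<close>
            and \<open>H\<close>, both already continuous in \<open>y'\<close>.\<close>
          have Lb: "L y' b = sgn (L y' a \<bullet> v) *\<^sub>R sgn (line_part v (H (b, y')))" if y': "y' \<in> ?M" for y'
          proof -
            have "continuous_on {a..b} (L y')"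
              by (rule continuous_on_subset[OF L(1)]) (use y' MY ab1 in auto)
            then have "continuous_on {a..b} (\<lambda>t. L y' t \<bullet> v)"
              by (intro continuous_intros)
            then have "connected ((\<lambda>t. L y' t \<bullet> v) ` {a..b})"
              by (intro connected_continuous_image) auto
            moreover have "L y' a \<bullet> v \<in> (\<lambda>t. L y' t \<bullet> v) ` {a..b}" "L y' b \<bullet> v \<in> (\<lambda>t. L y' t \<bullet> v) ` {a..b}"
              using ab by auto
            moreover have "0 \<notin> (\<lambda>t. L y' t \<bullet> v) ` {a..b}"
              using nz'[OF _ y'] by force
            ultimately have sg: "sgn (L y' a \<bullet> v) = sgn (L y' b \<bullet> v)" "L y' b \<bullet> v \<noteq> 0"
              using sgn_eq_on_connected by (blast, force)
            have Lb: "L y' b \<in> S2" "antipodal_class (L y' b) = H (b, y')"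
              using L(3)[of y' b] y' MY ab ab1 by auto
            show ?thesis
              unfolding Lb(2)[symmetric] sgn_line_part[OF Lb(1)] sg(1) using sg(2) by (auto simp: sgn_if)
          qed
          have "continuous_map (subtopology Y ?M) ?X (\<lambda>y'. (b, y'))"
            using ab ab1 x by (intro continuous_map_pairedI) auto
          from continuous_map_compose[OF this cont]
          have "continuous_map (subtopology Y ?M) euclidean (\<lambda>y'. line_part v (H (b, y')))"
            by (simp add: o_def)
          moreover have "continuous_map (subtopology Y ?M) euclidean (\<lambda>y'. L y' a)"
            using N'(3) by (rule continuous_map_from_subtopology_mono) auto
          ultimately have "continuous_map (subtopology Y ?M) (prod_topology euclidean euclidean)
              (\<lambda>y'. (L y' a, line_part v (H (b, y'))))"
            by (intro continuous_map_pairedI)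
          \<comment> \<open>\<open>sgn\<close> is continuous only away from 0, so the codomain is
            cut down before composing.\<close>
          then have "continuous_map (subtopology Y ?M) (top_of_set {z. fst z \<bullet> v \<noteq> 0 \<and> snd z \<noteq> 0})
              (\<lambda>y'. (L y' a, line_part v (H (b, y'))))"
            using nz nz' ab by (auto simp: continuous_map_in_subtopology)
          moreover have "continuous_on {z. fst z \<bullet> v \<noteq> 0 \<and> snd z \<noteq> 0}
              (\<lambda>z. sgn (fst z \<bullet> v) *\<^sub>R sgn (snd z :: real^3))"
            by (intro continuous_intros) auto
          ultimately have "continuous_map (subtopology Y ?M) euclidean
              (\<lambda>y'. sgn (L y' a \<bullet> v) *\<^sub>R sgn (line_part v (H (b, y'))))"
            by (auto dest: continuous_map_continuous_on_compose)
          then have "continuous_map (subtopology Y ?M) euclidean (\<lambda>y'. L y' b)"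
            by (rule continuous_map_eq) (use Lb in auto)
          then show "C y b"
            unfolding C_def using N N' by (intro exI[of _ ?M]) auto
        qed
      qed
    qed simp
    moreover have "C y 0"
    proof -
      have "continuous_map Y euclidean s"
        using s(1) by (rule continuous_map_into_fulltopology)
      then have "continuous_map (subtopology Y (topspace Y)) euclidean (\<lambda>y. L y 0)"
        by (rule continuous_map_eq[OF continuous_map_from_subtopology]) (use L(2) in auto)
      then show ?thesis
        unfolding C_def using y by blast
    qed
    ultimately show ?thesis
      by (simp add: P_def)
  qed
  then obtain N where N: "\<And>y. y \<in> topspace Y \<Longrightarrow> openin Y (N y) \<and> y \<in> N y \<and>
      continuous_map (subtopology Y (N y)) euclidean (\<lambda>y'. L y' 1)"
    unfolding C_def by metis
  have "continuous_map Y euclidean (\<lambda>y. L y 1)"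
    by (rule pasting_lemma[where I = "topspace Y" and T = N and f = "\<lambda>_ y. L y 1"]) (use N in auto)
  then have "continuous_map Y (top_of_set S2) (\<lambda>y. L y 1)"
    using L(3)[of _ 1] by (auto simp: continuous_map_in_subtopology)
  moreover have "\<forall>y\<in>topspace Y. antipodal_class (L y 1) = g y"
    using L(3)[of _ 1] H1 by auto
  ultimately show ?thesis
    unfolding liftable_def by blast
qed

section \<open>Liftability on contractible spaces and on unions\<close>

lemma liftable_compose: "liftable Y f \<Longrightarrow> continuous_map Z Y g \<Longrightarrow> liftable Z (f \<circ> g)"
  unfolding liftable_def
  by (metis comp_apply continuous_map_compose continuous_map_image_subset_topspace image_subset_iff)

lemma liftable_empty: "topspace Y = {} \<Longrightarrow> liftable Y f"
  unfolding liftable_def by (auto simp: continuous_map_on_empty)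

text \<open>A contraction of \<open>Y\<close> makes \<open>f\<close> homotopic to a constant map,
  which has a constant lift.\<close>

lemma liftable_contractible_space:
  assumes "contractible_space Y" and f: "continuous_map Y real_projective_plane f"
  shows "liftable Y f"
proof (cases "topspace Y = {}")
  case False
  then obtain a where a: "a \<in> topspace Y" and a_hom: "homotopic_with (\<lambda>_. True) Y Y id (\<lambda>_. a)"
    using assms(1) unfolding contractible_space_alt by blast
  have "homotopic_with (\<lambda>_. True) Y real_projective_plane (f \<circ> id) (f \<circ> (\<lambda>_. a))"
    using a_hom f by (rule homotopic_with_compose_continuous_map_left) auto
  then have "homotopic_with (\<lambda>_. True) Y real_projective_plane (\<lambda>_. f a) f"
    by (subst homotopic_with_sym) (simp add: o_def)
  moreover have "liftable Y (\<lambda>_. f a)"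
  proof -
    have "f a \<in> antipodal_class ` S2"
      using f a unfolding continuous_map_def topspace_real_projective_plane[symmetric] by auto
    then obtain x where "x \<in> S2" "f a = antipodal_class x"
      by blast
    then show ?thesis
      unfolding liftable_def by (intro exI[of _ "\<lambda>_. x"]) auto
  qed
  ultimately show ?thesis
    by (rule liftable_homotopic)
qed (rule liftable_empty)

text \<open>The inner product of the two lifts is continuous with values in {1, -1}, hence constant
  on a connected space.\<close>

lemma lifts_agree_up_to_sign:
  assumes Y: "connected_space Y"
    and s: "continuous_map Y (top_of_set S2) s" and t: "continuous_map Y (top_of_set S2) t"
    and eq: "\<And>y. y \<in> topspace Y \<Longrightarrow> antipodal_class (s y) = antipodal_class (t y)"
  shows "\<exists>e\<in>{1, -1::real}. \<forall>y\<in>topspace Y. s y = e *\<^sub>R t y"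
proof -
  have "continuous_map Y (prod_topology euclidean euclidean) (\<lambda>y. (s y, t y))"
    using s t by (intro continuous_map_pairedI) (auto simp: continuous_map_in_subtopology)
  moreover have "continuous_on UNIV (\<lambda>z. fst z \<bullet> (snd z::real^3))"
    by (intro continuous_intros)
  ultimately have cont: "continuous_map Y euclidean (\<lambda>y. s y \<bullet> t y)"
    using continuous_map_continuous_on_compose[of Y UNIV "\<lambda>y. (s y, t y)"] by fastforce
  have "connectedin euclidean ((\<lambda>y. s y \<bullet> t y) ` topspace Y)"
    using Y cont by (intro connectedin_continuous_map_image) (auto simp: connectedin_topspace)
  then have conn: "connected ((\<lambda>y. s y \<bullet> t y) ` topspace Y)"
    by simp
  have st: "s y \<bullet> t y = 1 \<and> s y = t y \<or> s y \<bullet> t y = -1 \<and> s y = - t y" if "y \<in> topspace Y" for y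
  proof -
    have "norm (t y) = 1"
      using t that by (auto simp: continuous_map_in_subtopology)
    then have "t y \<bullet> t y = 1"
      by (simp add: norm_eq_1)
    then show ?thesis
      using eq[OF that] by (auto simp: antipodal_class_eq_iff)
  qed
  have "\<not> (y \<in> topspace Y \<and> z \<in> topspace Y \<and> s y = t y \<and> s z = - t z)" for y z
  proof
    assume A: "y \<in> topspace Y \<and> z \<in> topspace Y \<and> s y = t y \<and> s z = - t z"
    then have "s y \<bullet> t y = 1" "s z \<bullet> t z = -1"
      using st by force+
    then have "{-1..1} \<subseteq> (\<lambda>y. s y \<bullet> t y) ` topspace Y"
      using A by (intro connected_contains_Icc[OF conn]) force+
    then have "0 \<in> (\<lambda>y. s y \<bullet> t y) ` topspace Y"
      by force
    then show False
      using st by force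
  qed
  then have "(\<forall>y\<in>topspace Y. s y = t y) \<or> (\<forall>y\<in>topspace Y. s y = - t y)"
    using st by blast
  then show ?thesis
    by auto
qed

text \<open>On the connected intersection the two lifts differ by one global sign; after multiplying
  one of them by it, they glue.\<close>

lemma liftable_Un:
  assumes U: "openin X U" "liftable (subtopology X U) f"
    and V: "openin X V" "liftable (subtopology X V) f"
    and UV: "connectedin X (U \<inter> V)"
  shows "liftable (subtopology X (U \<union> V)) f"
proof -
  have sub: "U \<subseteq> topspace X" "V \<subseteq> topspace X"
    using U V by (auto dest: openin_subset)
  obtain s where s: "continuous_map (subtopology X U) (top_of_set S2) s"
    "\<And>y. y \<in> U \<Longrightarrow> antipodal_class (s y) = f y"
    using U sub unfolding liftable_def by (auto simp: Int_absorb1)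
  obtain t where t: "continuous_map (subtopology X V) (top_of_set S2) t"
    "\<And>y. y \<in> V \<Longrightarrow> antipodal_class (t y) = f y"
    using V sub unfolding liftable_def by (auto simp: Int_absorb1)
  have "continuous_map (subtopology X (U \<inter> V)) (top_of_set S2) s"
    using s(1) by (rule continuous_map_from_subtopology_mono) auto
  moreover have "continuous_map (subtopology X (U \<inter> V)) (top_of_set S2) t"
    using t(1) by (rule continuous_map_from_subtopology_mono) auto
  ultimately have "\<exists>e\<in>{1, -1::real}. \<forall>y\<in>topspace (subtopology X (U \<inter> V)). s y = e *\<^sub>R t y"
    using UV s(2) t(2) by (intro lifts_agree_up_to_sign) (auto simp: connectedin_def)
  moreover have "topspace (subtopology X (U \<inter> V)) = U \<inter> V"
    using sub by auto
  ultimately obtain e :: real where e: "e \<in> {1, -1}" "\<And>y. y \<in> U \<inter> V \<Longrightarrow> s y = e *\<^sub>R t y"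
    by metis
  define r where "r y = (if y \<in> U then s y else e *\<^sub>R t y)" for y
  have "continuous_map (top_of_set S2) (top_of_set S2) (\<lambda>y. e *\<^sub>R y)"
    using e by (auto simp: continuous_map_in_subtopology intro!: continuous_intros)
  then have et: "continuous_map (subtopology X V) (top_of_set S2) (\<lambda>y. e *\<^sub>R t y)"
    by (rule continuous_map_compose[OF t(1), unfolded o_def])
  have "continuous_map (subtopology X (U \<union> V)) (top_of_set S2) r"
  proof (rule pasting_lemma[where I = "{True, False}" and T = "\<lambda>b. if b then U else V"
        and f = "\<lambda>b. if b then s else (\<lambda>y. e *\<^sub>R t y)"])
    show "openin (subtopology X (U \<union> V)) (if b then U else V)" for b
      using U V by (simp add: openin_open_subtopology openin_Un)
    show "continuous_map (subtopology (subtopology X (U \<union> V)) (if b then U else V)) (top_of_set S2)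
        (if b then s else (\<lambda>y. e *\<^sub>R t y))" for b
      using s(1) et by (auto simp: subtopology_subtopology Int_absorb1)
  qed (use e r_def in auto)
  moreover have "antipodal_class (r y) = f y" if "y \<in> U \<union> V" for y
    using that s(2) t(2) e by (auto simp: r_def)
  ultimately show ?thesis
    unfolding liftable_def by auto
qed

section \<open>Odd functions and the Borsuk-Ulam obstruction\<close>

text \<open>Simple connectedness of the sphere gives a logarithm \<open>g\<close> of
  \<open>z\<close>. Oddness makes \<open>g (- x) - g x\<close> an odd multiple of \<pi>i, which is
  constant by connectedness; but exchanging \<open>x\<close> and \<open>- x\<close> negates it, so
  it would be 0.\<close>

lemma no_odd_nonvanishing_sphere_map:
  fixes z :: "real^3 \<Rightarrow> complex"
  assumes cont: "continuous_on S2 z" and odd: "\<And>x. x \<in> S2 \<Longrightarrow> z (- x) = - z x"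
    and nz: "\<And>x. x \<in> S2 \<Longrightarrow> z x \<noteq> 0"
  shows False
proof -
  have "simply_connected S2"
    by (simp add: simply_connected_sphere)
  moreover have "locally path_connected S2"
    by (rule locally_path_connected_sphere)
  ultimately obtain g where g: "continuous_on S2 g" "\<And>x. x \<in> S2 \<Longrightarrow> z x = exp (g x)"
    using continuous_logarithm_on_simply_connected[OF cont] nz by blast
  define k where "k x = (g (- x) - g x) / (of_real pi * \<i>)" for x
  have k_Ints: "k x \<in> \<int> \<and> k x \<noteq> 0" if x: "x \<in> S2" for x
  proof -
    have "exp (g (- x)) = exp (g x + of_real pi * \<i>)"
      using g(2)[of x] g(2)[of "- x"] odd[OF x] x by (simp add: exp_add)
    then obtain n :: int where "g (- x) = g x + of_real pi * \<i> + of_int (2 * n) * of_real pi * \<i>"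
      unfolding exp_eq by (auto simp: mult.commute mult.left_commute)
    then have "g (- x) - g x = of_int (2 * n + 1) * (of_real pi * \<i>)"
      by (simp add: algebra_simps)
    then have "k x = of_int (2 * n + 1)"
      by (simp add: k_def)
    moreover have "2 * n + 1 \<noteq> 0"
      by presburger
    ultimately show ?thesis
      by (metis Ints_of_int of_int_eq_0_iff)
  qed
  have "continuous_on S2 (\<lambda>x. g (- x))"
    by (rule continuous_on_compose2[OF g(1)]) (auto intro!: continuous_intros)
  then have "continuous_on S2 k"
    unfolding k_def using g(1) by (intro continuous_intros) auto
  moreover have "connected S2"
    by (simp add: connected_sphere)
  moreover have "k ` S2 \<subseteq> \<int>"
    using k_Ints by blast
  ultimately have "k constant_on S2"
  proof (intro continuous_discrete_range_constant)
    fix x assume x: "x \<in> S2"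
    have "1 \<le> cmod (k y - k x)" if y: "y \<in> S2" "k y \<noteq> k x" for y
    proof -
      obtain m n where "k x = of_int m" "k y = of_int n"
        using k_Ints[OF x] k_Ints[OF y(1)] by (auto elim!: Ints_cases)
      then have "k y - k x = of_int (n - m)" "n - m \<noteq> 0"
        using y by auto
      then show ?thesis
        by (simp add: norm_of_int del: of_int_diff)
    qed
    then show "\<exists>e>0. \<forall>y. y \<in> S2 \<and> k y \<noteq> k x \<longrightarrow> e \<le> cmod (k y - k x)"
      by (intro exI[of _ 1]) auto
  qed
  then obtain c where c: "\<And>x. x \<in> S2 \<Longrightarrow> k x = c"
    unfolding constant_on_def by blast
  have x: "axis 1 1 \<in> S2" "- axis 1 1 \<in> S2"
    by simp_all
  have "k (- axis 1 1) = - k (axis 1 1)"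
    by (simp add: k_def field_simps)
  then have "c = 0"
    using c x by simp
  then show False
    using k_Ints[OF x(1)] c[OF x(1)] by simp
qed

text \<open>The lift splits the preimage \<open>D\<close> of \<open>A\<close> into an open set
  \<open>P\<close>, where it returns the point itself, and the antipodal set of \<open>P\<close>.
  The odd function compares the distances of \<open>x\<close> and \<open>- x\<close> to the
  complement of \<open>P\<close>.\<close>

lemma odd_function_of_liftable:
  assumes A: "openin real_projective_plane A"
    and lift: "liftable (subtopology real_projective_plane A) id"
  obtains \<psi> :: "real^3 \<Rightarrow> real" where "continuous_on S2 \<psi>" "\<And>x. \<psi> (- x) = - \<psi> x"
    "\<And>x. x \<in> S2 \<Longrightarrow> \<psi> x \<noteq> 0 \<longleftrightarrow> antipodal_class x \<in> A"
proof -
  have AT: "A \<subseteq> topspace real_projective_plane"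
    using A by (rule openin_subset)
  obtain s where s: "continuous_map (subtopology real_projective_plane A) (top_of_set S2) s"
    "\<And>c. c \<in> A \<Longrightarrow> antipodal_class (s c) = c"
    using lift AT unfolding liftable_def by (auto simp: Int_absorb1)
  define D where "D = {x \<in> S2. antipodal_class x \<in> A}"
  have D: "openin (top_of_set S2) D"
    using A unfolding openin_real_projective_plane D_def by simp
  have sD: "s (antipodal_class x) = x \<or> s (antipodal_class x) = - x" if "x \<in> D" for x
    using s(2)[of "antipodal_class x"] that by (simp add: D_def antipodal_class_eq_iff)
  define P where "P = {x \<in> D. 0 < s (antipodal_class x) \<bullet> x}"
  have P_iff: "x \<in> P \<longleftrightarrow> s (antipodal_class x) = x" if "x \<in> D" for x
    using sD[OF that] that unfolding P_def by (auto simp: D_def inner_gt_zero_iff)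
      (metis inner_ge_zero not_less)
  have P_uminus: "- x \<in> P \<longleftrightarrow> x \<notin> P" if "x \<in> D" for x
  proof -
    have "- x \<in> D" "x \<bullet> x = 1"
      using that by (auto simp: D_def norm_eq_1)
    moreover from this have "x \<noteq> - x"
      by (metis inner_minus_left one_neq_neg_one)
    ultimately show ?thesis
      using P_iff[of x] P_iff[of "- x"] sD[OF that] that by (metis antipodal_class_uminus)
  qed
  have "continuous_map (top_of_set D) (subtopology real_projective_plane A) antipodal_class"
  proof -
    have "D \<subseteq> S2"
      by (auto simp: D_def)
    from continuous_map_from_subtopology_mono[OF continuous_map_antipodal_class this] show ?thesis
      by (auto simp: continuous_map_in_subtopology D_def)
  qed
  then have "continuous_map (top_of_set D) (top_of_set S2) (s \<circ> antipodal_class)"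
    using s(1) by (rule continuous_map_compose)
  then have "continuous_on D (\<lambda>x. s (antipodal_class x))"
    by (simp add: continuous_map_in_subtopology o_def)
  then have "continuous_on D (\<lambda>x. s (antipodal_class x) \<bullet> x)"
    by (intro continuous_intros)
  then have "openin (top_of_set D) (D \<inter> (\<lambda>x. s (antipodal_class x) \<bullet> x) -` {0<..})"
    by (rule continuous_openin_preimage_gen) auto
  moreover have "D \<inter> (\<lambda>x. s (antipodal_class x) \<bullet> x) -` {0<..} = P"
    by (auto simp: P_def)
  ultimately have "openin (top_of_set S2) P"
    using D openin_trans by metis
  then have "closedin (top_of_set S2) (S2 - P)"
    by (intro closedin_diff) auto
  then have cl: "closed (S2 - P)"
    by (rule closedin_closed_trans) simp
  have PD: "P \<subseteq> D" "D \<subseteq> S2" "\<And>x. - x \<in> D \<longleftrightarrow> x \<in> D"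
    by (auto simp: P_def D_def)
  \<comment> \<open>\<open>infdist\<close> to the empty set is 0 by convention, so the complement
    must be nonempty. It is, since \<open>P\<close> never contains both points of an antipodal
    pair.\<close>
  have ne: "S2 - P \<noteq> {}"
  proof
    assume "S2 - P = {}"
    moreover have "axis 1 1 \<in> S2" "- axis 1 1 \<in> S2"
      by simp_all
    ultimately show False
      using P_uminus[of "axis 1 1"] PD(1) by blast
  qed
  \<comment> \<open>On the sphere, if \<open>x\<close> is in \<open>P\<close> then only the first
    term is positive; if \<open>- x\<close> is in \<open>P\<close>, only the second; outside
    \<open>D\<close> both are 0.\<close>
  define \<psi> where "\<psi> x = infdist x (S2 - P) - infdist (- x) (S2 - P)" for x
  show ?thesis
  proof
    show "continuous_on S2 \<psi>"
      unfolding \<psi>_def by (intro continuous_intros)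
    show "\<psi> (- x) = - \<psi> x" for x
      by (simp add: \<psi>_def)
    show "\<psi> x \<noteq> 0 \<longleftrightarrow> antipodal_class x \<in> A" if x: "x \<in> S2" for x
    proof -
      have zero: "infdist y (S2 - P) = 0 \<longleftrightarrow> y \<notin> P" if "y \<in> S2" for y
        using in_closed_iff_infdist_zero[OF cl ne, of y] that by blast
      have "- x \<in> S2"
        using x by simp
      then have "\<psi> x \<noteq> 0 \<longleftrightarrow> x \<in> D"
        using zero[OF x] zero[of "- x"] P_uminus[of x] PD unfolding \<psi>_def
        by (cases "x \<in> D") auto
      then show ?thesis
        using x by (simp add: D_def)
    qed
  qed
qed

text \<open>The cover is pulled back along \<open>g\<close> to the projective plane, and each member
  yields an odd function supported on its preimage in the sphere. Without triple points, a suitable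
  complex combination of these functions would be odd and nowhere zero.\<close>

lemma liftable_cover_has_triple_point:
  assumes f: "continuous_map X real_projective_plane f" and g: "continuous_map real_projective_plane X g"
    and fg: "homotopic_with (\<lambda>_. True) real_projective_plane real_projective_plane (f \<circ> g) id"
    and \<V>: "finite \<V>" "\<Union>\<V> = topspace X"
      "\<And>V. V \<in> \<V> \<Longrightarrow> openin X V \<and> liftable (subtopology X V) f"
  shows "\<exists>U\<in>\<V>. \<exists>V\<in>\<V>. \<exists>W\<in>\<V>. U \<noteq> V \<and> U \<noteq> W \<and> V \<noteq> W \<and> U \<inter> V \<inter> W \<noteq> {}"
proof (rule ccontr)
  assume notriple: "\<not> ?thesis"
  let ?R = real_projective_plane
  define A where "A V = {c \<in> topspace ?R. g c \<in> V}" for V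
  have A: "openin ?R (A V)" "liftable (subtopology ?R (A V)) id" if V: "V \<in> \<V>" for V
  proof -
    show "openin ?R (A V)"
      unfolding A_def using \<V>(3)[OF V] openin_continuous_map_preimage[OF g] by blast
    have cg: "continuous_map (subtopology ?R (A V)) (subtopology X V) g"
      using g by (auto simp: continuous_map_in_subtopology A_def intro: continuous_map_from_subtopology)
    \<comment> \<open>On \<open>A V\<close> the map \<open>f \<circ> g\<close> lifts through the
      lift over \<open>V\<close>; the restricted homotopy transfers this to the inclusion of
      \<open>A V\<close>.\<close>
    have "homotopic_with (\<lambda>_. True) (subtopology ?R (A V)) ?R (f \<circ> g \<circ> id) (id \<circ> id)"
      using fg by (rule homotopic_with_compose_continuous_map_right)
        (auto intro: continuous_map_from_subtopology)
    moreover have "liftable (subtopology ?R (A V)) (f \<circ> g)"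
      using liftable_compose[OF _ cg] \<V>(3)[OF V] by blast
    ultimately show "liftable (subtopology ?R (A V)) id"
      using liftable_homotopic by (metis comp_id)
  qed
  have "\<exists>\<psi> :: real^3 \<Rightarrow> real. continuous_on S2 \<psi> \<and> (\<forall>x. \<psi> (- x) = - \<psi> x) \<and>
      (\<forall>x\<in>S2. \<psi> x \<noteq> 0 \<longleftrightarrow> antipodal_class x \<in> A V)" if "V \<in> \<V>" for V
    using odd_function_of_liftable[OF A[OF that]] by metis
  then obtain \<psi> :: "_ \<Rightarrow> real^3 \<Rightarrow> real" where \<psi>: "\<And>V. V \<in> \<V> \<Longrightarrow> continuous_on S2 (\<psi> V)"
    "\<And>V x. V \<in> \<V> \<Longrightarrow> \<psi> V (- x) = - \<psi> V x"
    "\<And>V x. V \<in> \<V> \<Longrightarrow> x \<in> S2 \<Longrightarrow> \<psi> V x \<noteq> 0 \<longleftrightarrow> antipodal_class x \<in> A V"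
    by metis
  obtain k :: "_ \<Rightarrow> nat" where k: "inj_on k \<V>"
    using finite_imp_inj_to_nat_seg[OF \<V>(1)] by blast
  \<comment> \<open>At most two of the \<open>\<psi> V x\<close> are nonzero, and the coefficients are pairwise linearly independent over the reals.\<close>
  define z where "z x = (\<Sum>V\<in>\<V>. of_real (\<psi> V x) * Complex 1 (k V))" for x
  show False
  proof (rule no_odd_nonvanishing_sphere_map)
    show "continuous_on S2 z"
      unfolding z_def using \<psi>(1) by (intro continuous_intros) auto
    show "z (- x) = - z x" for x
      unfolding z_def sum_negf[symmetric] using \<psi>(2) by (intro sum.cong) auto
    show "z x \<noteq> 0" if x: "x \<in> S2" for x
    proof
      assume z: "z x = 0"
      define c where "c = antipodal_class x"
      have c: "c \<in> topspace ?R"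
        using x unfolding c_def topspace_real_projective_plane by blast
      then have "g c \<in> \<Union>\<V>"
        using g unfolding \<V>(2) continuous_map_def by auto
      then obtain U where U: "U \<in> \<V>" "g c \<in> U"
        by blast
      have nz: "\<psi> V x \<noteq> 0 \<longleftrightarrow> g c \<in> V" if "V \<in> \<V>" for V
        using \<psi>(3)[OF that x] c by (simp add: A_def c_def)
      obtain V where V: "V \<in> \<V>" "\<And>W. W \<in> \<V> \<Longrightarrow> g c \<in> W \<Longrightarrow> W = U \<or> W = V"
      proof (cases "\<exists>V\<in>\<V>. V \<noteq> U \<and> g c \<in> V")
        case True
        then obtain V where "V \<in> \<V>" "V \<noteq> U" "g c \<in> V"
          by blast
        then show ?thesis
          using that notriple U by (metis IntI empty_iff)
      next
        case False
        then show ?thesis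
          using that U by blast
      qed
      have "z x = (\<Sum>V\<in>{U, V}. of_real (\<psi> V x) * Complex 1 (k V))"
        unfolding z_def using \<V>(1) U V nz by (intro sum.mono_neutral_right) auto
      show False
      proof (cases "U = V")
        case True
        then show False
          using \<open>z x = (\<Sum>V\<in>{U, V}. _ V)\<close> z nz[OF U(1)] U(2) by (simp add: complex_eq_iff)
      next
        case False
        then have "\<psi> U x + \<psi> V x = 0" "\<psi> U x * k U + \<psi> V x * k V = 0"
          using \<open>z x = (\<Sum>V\<in>{U, V}. _ V)\<close> z by (auto simp: complex_eq_iff)
        then have "\<psi> U x * (real (k U) - real (k V)) = 0"
          by (simp add: algebra_simps eq_neg_iff_add_eq_0[symmetric])
        moreover have "k U \<noteq> k V"
          using False k U V by (auto simp: inj_on_def)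
        ultimately show False
          using nz[OF U(1)] U(2) by simp
      qed
    qed
  qed
qed

section \<open>The lower bound for good covers\<close>

lemma good_cover_card_ge_6:
  assumes hom: "X homotopy_equivalent_space real_projective_plane"
    and \<U>: "finite \<U>" "good_cover X \<U>"
  shows "6 \<le> card \<U>"
proof (rule ccontr)
  assume "\<not> 6 \<le> card \<U>"
  then have card: "card \<U> \<le> 5"
    by simp
  obtain f g where f: "continuous_map X real_projective_plane f" and g: "continuous_map real_projective_plane X g"
    and fg: "homotopic_with (\<lambda>_. True) real_projective_plane real_projective_plane (f \<circ> g) id"
    using hom unfolding homotopy_equivalent_space_def by blast
  have op: "openin X U" "liftable (subtopology X U) f" if "U \<in> \<U>" for U
    using \<U>(2) that f unfolding good_cover_def
    by (auto intro: liftable_contractible_space continuous_map_from_subtopology)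
  have conn: "connectedin X (U \<inter> V)" if "U \<in> \<U>" "V \<in> \<U>" for U V
  \<comment> \<open>A good cover constrains only nonempty intersections. The empty set counts as
    connected, so disjoint members can be merged as well.\<close>
  proof (cases "U \<inter> V = {}")
    case False
    then have "contractible_space (subtopology X (\<Inter>{U, V}))"
      using \<U>(2) that unfolding good_cover_def by (metis empty_subsetI finite.emptyI finite.insertI
          Inter_insert Inf_empty inf_top.right_neutral insert_not_empty insert_subset)
    then show ?thesis
      using op(1) that by (auto simp: connectedin_def contractible_imp_connected_space dest: openin_subset)
  qed auto
  have cov: "\<Union>\<U> = topspace X"
    using \<U>(2) by (simp add: good_cover_def)
  obtain U V W where UVW: "U \<in> \<U>" "V \<in> \<U>" "W \<in> \<U>" "U \<noteq> V" "U \<noteq> W" "V \<noteq> W" "U \<inter> V \<inter> W \<noteq> {}"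
    using liftable_cover_has_triple_point[OF f g fg \<U>(1) cov] op by metis
  define A where "A = U \<union> V \<union> W"
  define B where "B = \<Union>(\<U> - {U, V, W})"
  \<comment> \<open>The common point of the three members joins the two connected pieces, so that
    \<open>W\<close> can be merged with \<open>U \<union> V\<close>.\<close>
  have "connectedin X ((U \<inter> W) \<union> (V \<inter> W))"
    using UVW(7) conn[OF UVW(1,3)] conn[OF UVW(2,3)] by (intro connectedin_Un) auto
  then have "connectedin X ((U \<union> V) \<inter> W)"
    by (simp add: Int_Un_distrib2)
  then have A: "openin X A" "liftable (subtopology X A) f"
    unfolding A_def using op[OF UVW(1)] op[OF UVW(2)] op[OF UVW(3)] conn[OF UVW(1,2)]
    by (simp_all add: openin_Un liftable_Un)
  have "card (\<U> - {U, V, W}) \<le> 2"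
    using card UVW \<U>(1) by (simp add: card_Diff_subset)
  then have "card (\<U> - {U, V, W}) = 0 \<or> card (\<U> - {U, V, W}) = 1 \<or> card (\<U> - {U, V, W}) = 2"
    by linarith
  then have B: "openin X B \<and> liftable (subtopology X B) f"
  proof (elim disjE)
    assume "card (\<U> - {U, V, W}) = 0"
    then have "\<U> - {U, V, W} = {}"
      using \<U>(1) by simp
    then have "B = {}"
      unfolding B_def by (simp only: Union_empty)
    then show ?thesis
      by (simp_all add: liftable_empty)
  next
    assume "card (\<U> - {U, V, W}) = 1"
    then obtain Y where "\<U> - {U, V, W} = {Y}"
      by (auto simp: card_1_singleton_iff)
    moreover from this have "Y \<in> \<U>"
      by blast
    ultimately show ?thesis
      using op by (simp_all add: B_def)
  next
    assume "card (\<U> - {U, V, W}) = 2"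
    then obtain Y Z where YZ: "\<U> - {U, V, W} = {Y, Z}"
      by (auto simp: card_2_iff)
    then have Y: "Y \<in> \<U>" and Z: "Z \<in> \<U>"
      by blast+
    have "B = Y \<union> Z"
      unfolding B_def YZ by simp
    then show ?thesis
      using op[OF Y] op[OF Z] conn[OF Y Z] by (simp add: liftable_Un openin_Un)
  qed
  have "\<Union>{A, B} = topspace X"
    using cov UVW unfolding A_def B_def by blast
  moreover have "\<And>V. V \<in> {A, B} \<Longrightarrow> openin X V \<and> liftable (subtopology X V) f"
    using A B by blast
  \<comment> \<open>The contradiction: a set \<open>{A, B}\<close> has no three distinct
    members.\<close>
  ultimately have "\<exists>U\<in>{A, B}. \<exists>V\<in>{A, B}. \<exists>W\<in>{A, B}. U \<noteq> V \<and> U \<noteq> W \<and> V \<noteq> W \<and> U \<inter> V \<inter> W \<noteq> {}"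
    by (intro liftable_cover_has_triple_point[OF f g fg]) auto
  then show False
    by blast
qed

section \<open>Contractibility of intersections of spherical caps\<close>

text \<open>The straight-line homotopy to a point \<open>a\<close> of the region, pushed radially
  back to the sphere. Convex combinations keep the bounds and have norm at most 1, so normalising
  only enlarges the positive inner products; the member \<open>w\<close> keeps the segments away
  from the origin.\<close>

lemma contractible_sphere_cap:
  assumes t: "0 < t" and W: "w \<in> W"
  shows "contractible {x \<in> S2. \<forall>v\<in>W. t < x \<bullet> v}"
proof (cases "{x \<in> S2. \<forall>v\<in>W. t < x \<bullet> v} = {}")
  case False
  let ?T = "{x \<in> S2. \<forall>v\<in>W. t < x \<bullet> v}"
  obtain a where a: "a \<in> ?T"
    using False by blast
  let ?h = "\<lambda>z. (1 - fst z) *\<^sub>R snd z + fst z *\<^sub>R a"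
  have h: "?h (s, x) \<noteq> 0 \<and> sgn (?h (s, x)) \<in> ?T" if s: "s \<in> {0..1}" and x: "x \<in> ?T" for s x
  proof -
    have gt: "t < ?h (s, x) \<bullet> v" if "v \<in> W" for v
    proof -
      have "t < x \<bullet> v" "t < a \<bullet> v"
        using a x that by auto
      then have "- (x \<bullet> v) < - t" "- (a \<bullet> v) < - t"
        by auto
      then have "(1 - s) * - (x \<bullet> v) + s * - (a \<bullet> v) < - t"
        using s by (intro convex_bound_lt) auto
      then show ?thesis
        by (simp add: inner_add_left)
    qed
    have nz: "?h (s, x) \<noteq> 0"
      using gt[OF W] t by (metis inner_zero_left less_asym)
    have "norm (?h (s, x)) \<le> norm ((1 - s) *\<^sub>R x) + norm (s *\<^sub>R a)"
      unfolding fst_conv snd_conv by (rule norm_triangle_ineq)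
    also have "\<dots> = 1"
      using s x a by simp
    finally have le: "norm (?h (s, x)) \<le> 1" .
    have "t < sgn (?h (s, x)) \<bullet> v" if "v \<in> W" for v
    proof -
      have "t < ?h (s, x) \<bullet> v"
        using gt that .
      also have "\<dots> \<le> (?h (s, x) \<bullet> v) / norm (?h (s, x))"
        using nz le gt[OF that] t by (auto simp: pos_le_divide_eq mult_left_le)
      finally show ?thesis
        by (simp add: sgn_div_norm divide_inverse_commute)
    qed
    then show ?thesis
      using nz by (simp add: norm_sgn)
  qed
  have "continuous_on ({0..1} \<times> ?T) (\<lambda>z. sgn (?h z))"
    using h by (intro continuous_intros) auto
  moreover have "(\<lambda>z. sgn (?h z)) \<in> ({0..1} \<times> ?T) \<rightarrow> ?T"
    using h by force
  moreover have "\<forall>x\<in>?T. sgn (?h (0, x)) = id x" "\<forall>x\<in>?T. sgn (?h (1, x)) = a"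
    using a by (auto simp: sgn_div_norm)
  ultimately have "homotopic_with_canon (\<lambda>_. True) ?T ?T id (\<lambda>_. a)"
    by (subst homotopic_with) (auto intro!: exI[of _ "\<lambda>z. sgn (?h z)"] simp: continuous_map_in_subtopology)
  then show ?thesis
    unfolding contractible_def by blast
next
  case True
  then show ?thesis
    by (simp only: contractible_empty)
qed

text \<open>The region lies in the open hemisphere around \<open>w\<close>, so
  \<open>antipodal_class\<close> is a homeomorphism from it onto its image, with the normalised
  \<open>line_part w\<close> as inverse.\<close>

lemma contractible_space_projective_cap:
  assumes t: "0 < t" and W: "w \<in> W"
  shows "contractible_space (subtopology real_projective_plane
           (antipodal_class ` {x \<in> S2. \<forall>v\<in>W. t < x \<bullet> v}))"
proof -
  let ?T = "{x \<in> S2. \<forall>v\<in>W. t < x \<bullet> v}"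
  have sec: "sgn (line_part w (antipodal_class x)) = x" if "x \<in> ?T" for x
    using that t W sgn_line_part[of x w] by force
  have "continuous_map (subtopology real_projective_plane (antipodal_class ` ?T)) (top_of_set (- {0})) (line_part w)"
    using continuous_map_from_subtopology[OF continuous_map_line_part[of w]] t W
    by (auto simp: continuous_map_in_subtopology)
  moreover have "continuous_on (- {0}) (sgn :: real^3 \<Rightarrow> _)"
    by (intro continuous_intros) auto
  ultimately have "continuous_map (subtopology real_projective_plane (antipodal_class ` ?T)) euclidean
      (\<lambda>c. sgn (line_part w c))"
    by (rule continuous_map_continuous_on_compose)
  then have "continuous_map (subtopology real_projective_plane (antipodal_class ` ?T)) (top_of_set ?T)
      (\<lambda>c. sgn (line_part w c))"
    using sec by (auto simp: continuous_map_in_subtopology)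
  moreover have "continuous_map (top_of_set ?T) (subtopology real_projective_plane (antipodal_class ` ?T)) antipodal_class"
  proof -
    have "?T \<subseteq> S2"
      by blast
    from continuous_map_from_subtopology_mono[OF continuous_map_antipodal_class this] show ?thesis
      by (simp add: continuous_map_in_subtopology)
  qed
  ultimately have "top_of_set ?T homeomorphic_space subtopology real_projective_plane (antipodal_class ` ?T)"
    unfolding homeomorphic_space_def homeomorphic_maps_def using sec by fastforce
  then show ?thesis
    using contractible_sphere_cap[OF assms] by (simp flip: homeomorphic_space_contractibility)
qed

section \<open>The icosahedral cover by six caps\<close>

text \<open>
  For the vectors \<open>v\<close> of \<open>ico\<close> below, caps of radius parameter \<open>r\<close> cover the plane if
  \<open>r\<^sup>2 < 10/6\<close> (average \<open>(x \<bullet> v)\<^sup>2\<close> over \<open>ico\<close>) and have connected intersections if \<open>r\<^sup>2 \<ge> 6/4\<close>.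
\<close>

definition cap :: "real^3 \<Rightarrow> (real^3) set set" where
  "cap v = antipodal_class ` {x \<in> S2. 5/4 < \<bar>x \<bullet> v\<bar>}"

lemma antipodal_class_in_cap: "x \<in> S2 \<Longrightarrow> antipodal_class x \<in> cap v \<longleftrightarrow> 5/4 < \<bar>x \<bullet> v\<bar>"
  unfolding cap_def by (auto simp: antipodal_class_eq_iff)

lemma openin_cap: "openin real_projective_plane (cap v)"
proof -
  have "openin (top_of_set S2) (S2 \<inter> (\<lambda>x. \<bar>x \<bullet> v\<bar>) -` {5/4<..})"
    by (intro continuous_openin_preimage_gen continuous_intros open_greaterThan)
  moreover have "S2 \<inter> (\<lambda>x. \<bar>x \<bullet> v\<bar>) -` {5/4<..} = {x \<in> S2. antipodal_class x \<in> cap v}"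
    by (auto simp: antipodal_class_in_cap)
  moreover have "cap v \<subseteq> antipodal_class ` S2"
    by (auto simp: cap_def)
  ultimately show ?thesis
    unfolding openin_real_projective_plane by simp
qed

text \<open>Rational approximations to one vertex from each antipodal pair of a regular icosahedron.\<close>

definition ico :: "(real^3) set" where
  "ico = {vector [0, 1, 2], vector [0, -1, 2], vector [2, 0, 1],
          vector [2, 0, -1], vector [1, 2, 0], vector [-1, 2, 0]}"

text \<open>This gap around 0 is what fixes signs: once an inner product is known to exceed -2, it
  is at least 2.\<close>

lemma ico_inner: "v \<in> ico \<Longrightarrow> w \<in> ico \<Longrightarrow> 2 \<le> \<bar>v \<bullet> w\<bar>"
  by (auto simp: ico_def inner_vec_def sum_3 vector_3)

lemma ico_inner_self: "v \<in> ico \<Longrightarrow> v \<bullet> v = 5"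
  by (auto simp: ico_def inner_vec_def sum_3 vector_3)

text \<open>The squares of the six inner products sum to 10 for a unit vector \<open>x\<close>,
  whereas six squares of at most 25/16 sum to at most 75/8.\<close>

lemma ico_caps_cover:
  assumes "x \<in> S2"
  shows "\<exists>v\<in>ico. 5/4 < \<bar>x \<bullet> v\<bar>"
proof (rule ccontr)
  assume "\<not> ?thesis"
  then have le: "(x \<bullet> v)\<^sup>2 \<le> (5/4)\<^sup>2" if "v \<in> ico" for v
    using that by (metis abs_le_square_iff abs_of_nonneg divide_nonneg_nonneg not_less zero_le_numeral)
  have "x \<bullet> x = 1"
    using assms by (simp add: norm_eq_1)
  then have "x$1 * x$1 + x$2 * x$2 + x$3 * x$3 = 1"
    by (simp add: inner_vec_def sum_3)
  moreover have "(x$2 + 2 * x$3)\<^sup>2 \<le> (5/4)\<^sup>2" "(- x$2 + 2 * x$3)\<^sup>2 \<le> (5/4)\<^sup>2"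
      "(2 * x$1 + x$3)\<^sup>2 \<le> (5/4)\<^sup>2" "(2 * x$1 - x$3)\<^sup>2 \<le> (5/4)\<^sup>2"
      "(x$1 + 2 * x$2)\<^sup>2 \<le> (5/4)\<^sup>2" "(- x$1 + 2 * x$2)\<^sup>2 \<le> (5/4)\<^sup>2"
    using le[of "vector [0, 1, 2]"] le[of "vector [0, -1, 2]"] le[of "vector [2, 0, 1]"]
      le[of "vector [2, 0, -1]"] le[of "vector [1, 2, 0]"] le[of "vector [-1, 2, 0]"]
    by (simp_all add: ico_def inner_vec_def sum_3 vector_3 mult.commute)
  ultimately show False
    by (simp add: power2_eq_square algebra_simps)
qed

text \<open>Cauchy-Schwarz applied to \<open>x\<close> and \<open>a + b\<close> gives
  \<open>10 + 2 * (a \<bullet> b) > 25/4\<close>, so the inner product even exceeds -15/8.\<close>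

lemma close_to_both_imp_inner_gt:
  fixes x a b :: "real^3"
  assumes "norm x = 1" "5/4 < x \<bullet> a" "5/4 < x \<bullet> b" "a \<bullet> a = 5" "b \<bullet> b = 5"
  shows "-2 < a \<bullet> b"
proof -
  have "5/2 < x \<bullet> (a + b)"
    using assms by (simp add: inner_add_right)
  also have "\<dots> \<le> norm (a + b)"
    using norm_cauchy_schwarz[of x "a + b"] assms by simp
  finally have "(5/2)\<^sup>2 < (norm (a + b))\<^sup>2"
    by (intro power_strict_mono) auto
  also have "\<dots> = 10 + 2 * (a \<bullet> b)"
    using assms by (simp add: power2_norm_eq_inner inner_add_left inner_add_right inner_commute)
  finally show ?thesis
    by (simp add: power2_eq_square)
qed

text \<open>Orient every \<open>v\<close> in \<open>J\<close> towards one common point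
  \<open>a\<close>; the oriented vectors \<open>e v\<close> then have inner product at least 2 with
  \<open>e u\<close>. If a point \<open>x\<close> near \<open>e u\<close> were near
  \<open>- e v\<close>, that inner product would be below 2. So one choice of signs works for the
  whole intersection, which is therefore the image of a single region of the sphere.\<close>

lemma Inter_caps_eq:
  assumes J: "J \<subseteq> ico" "J \<noteq> {}" and ne: "(\<Inter>v\<in>J. cap v) \<noteq> {}"
  obtains W where "W \<noteq> {}" "(\<Inter>v\<in>J. cap v) = antipodal_class ` {x \<in> S2. \<forall>w\<in>W. 5/4 < x \<bullet> w}"
proof -
  obtain u where u: "u \<in> J"
    using J by blast
  obtain a where a: "a \<in> S2" "antipodal_class a \<in> (\<Inter>v\<in>J. cap v)"
  proof -
    obtain c where c: "c \<in> (\<Inter>v\<in>J. cap v)"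
      using ne by blast
    then obtain y where "y \<in> S2" "c = antipodal_class y"
      using u unfolding cap_def by blast
    then show thesis
      using that c by blast
  qed
  define e where "e v = (if 0 < a \<bullet> v then v else - v)" for v
  have ae: "5/4 < a \<bullet> e v" if "v \<in> J" for v
    using a that antipodal_class_in_cap[OF a(1), of v] by (auto simp: e_def abs_if split: if_splits)
  have ee: "e v \<bullet> e v = 5" "2 \<le> \<bar>e u \<bullet> e v\<bar>" if "v \<in> J" for v
    using that J u ico_inner[of u v] ico_inner_self[of v] by (auto simp: e_def)
  \<comment> \<open>Both vectors are near \<open>a\<close>, so their inner product exceeds -2, and
    the gap in \<open>ico_inner\<close> lifts it to 2.\<close>
  have eu: "2 \<le> e u \<bullet> e v" if "v \<in> J" for v
    using close_to_both_imp_inner_gt[of a "e u" "e v"] ae ee that u a by force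
  have abs_e: "\<bar>x \<bullet> e v\<bar> = \<bar>x \<bullet> v\<bar>" for x v
    by (simp add: e_def)
  have "(\<Inter>v\<in>J. cap v) = antipodal_class ` {x \<in> S2. \<forall>w\<in>e ` J. 5/4 < x \<bullet> w}"
  proof (intro equalityI subsetI)
    fix c assume c: "c \<in> (\<Inter>v\<in>J. cap v)"
    then obtain x where x: "x \<in> S2" "c = antipodal_class x" "0 \<le> x \<bullet> e u"
    proof -
      obtain y where y: "y \<in> S2" "c = antipodal_class y"
        using c u unfolding cap_def by blast
      show thesis
        using that[of y] that[of "- y"] y by (cases "0 \<le> y \<bullet> e u") auto
    qed
    have gt: "5/4 < \<bar>x \<bullet> e v\<bar>" if "v \<in> J" for v
      using c that antipodal_class_in_cap[OF x(1), of v] x(2) by (auto simp: abs_e)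
    have "5/4 < x \<bullet> e v" if v: "v \<in> J" for v
    proof (rule ccontr)
      assume "\<not> 5/4 < x \<bullet> e v"
      then have "5/4 < x \<bullet> - e v"
        using gt[OF v] by auto
      then have "-2 < e u \<bullet> - e v"
        using close_to_both_imp_inner_gt[of x "e u" "- e v"] gt[OF u] x ee u v by auto
      then show False
        using eu[OF v] by simp
    qed
    then show "c \<in> antipodal_class ` {x \<in> S2. \<forall>w\<in>e ` J. 5/4 < x \<bullet> w}"
      using x by blast
  next
    fix c assume "c \<in> antipodal_class ` {x \<in> S2. \<forall>w\<in>e ` J. 5/4 < x \<bullet> w}"
    then obtain x where x: "x \<in> S2" "c = antipodal_class x" "\<And>v. v \<in> J \<Longrightarrow> 5/4 < x \<bullet> e v"
      by auto
    have "5/4 < \<bar>x \<bullet> v\<bar>" if "v \<in> J" for v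
      using x(3)[OF that] abs_e[of x v] by linarith
    then show "c \<in> (\<Inter>v\<in>J. cap v)"
      using x antipodal_class_in_cap by auto
  qed
  then show ?thesis
    using that[of "e ` J"] u by blast
qed

lemma contractible_space_Inter_caps:
  assumes J: "J \<subseteq> ico" "J \<noteq> {}" and ne: "(\<Inter>v\<in>J. cap v) \<noteq> {}"
  shows "contractible_space (subtopology real_projective_plane (\<Inter>v\<in>J. cap v))"
proof -
  obtain W where "W \<noteq> {}" and eq: "(\<Inter>v\<in>J. cap v) = antipodal_class ` {x \<in> S2. \<forall>w\<in>W. 5/4 < x \<bullet> w}"
    using Inter_caps_eq[OF assms] .
  then obtain w where "w \<in> W"
    by blast
  then show ?thesis
    unfolding eq by (intro contractible_space_projective_cap) auto
qed

lemma good_cover_caps: "good_cover real_projective_plane (cap ` ico)"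
  unfolding good_cover_def
proof (intro conjI ballI allI impI)
  fix U assume "U \<in> cap ` ico"
  then obtain v where v: "v \<in> ico" "U = cap v"
    by blast
  show "openin real_projective_plane U"
    using v openin_cap by simp
  show ne: "U \<noteq> {}"
  proof -
    have "v \<noteq> 0" "norm v = sqrt 5"
      using ico_inner_self[OF v(1)] by (auto simp: norm_eq_sqrt_inner)
    \<comment> \<open>The centre of the cap serves as its witness point.\<close>
    then have "sgn v \<in> S2"
      by (simp add: norm_sgn)
    moreover have "sgn v \<bullet> v = sqrt 5"
      using ico_inner_self[OF v(1)] \<open>norm v = sqrt 5\<close> by (simp add: sgn_div_norm inverse_eq_divide real_div_sqrt)
    moreover have "5/4 < sqrt 5"
      by (rule real_less_rsqrt) (simp add: power2_eq_square)
    ultimately show ?thesis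
      using antipodal_class_in_cap[of "sgn v" v] v(2) by auto
  qed
  show "contractible_space (subtopology real_projective_plane U)"
    using contractible_space_Inter_caps[of "{v}"] v ne by simp
next
  show "\<Union> (cap ` ico) = topspace real_projective_plane"
  proof
    show "\<Union> (cap ` ico) \<subseteq> topspace real_projective_plane"
      by (auto simp: topspace_real_projective_plane cap_def)
    show "topspace real_projective_plane \<subseteq> \<Union> (cap ` ico)"
      using ico_caps_cover antipodal_class_in_cap by (auto simp: topspace_real_projective_plane)
  qed
next
  fix \<F> assume \<F>: "\<F> \<subseteq> cap ` ico \<and> finite \<F> \<and> \<F> \<noteq> {} \<and> \<Inter>\<F> \<noteq> {}"
  then obtain J where "J \<subseteq> ico" "\<F> = cap ` J"
    by (auto simp: subset_image_iff)
  then show "contractible_space (subtopology real_projective_plane (\<Inter>\<F>))"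
    using contractible_space_Inter_caps[of J] \<F> by auto
qed

section \<open>Combining the two bounds\<close>

theorem theorem5p4:
  shows "covering_type TYPE((real^3) set) real_projective_plane = 6 \<and>
         6 \<le> covering_type TYPE('b) real_projective_plane"
proof -
  \<comment> \<open>The type variable \<open>'c\<close> is generalised, so that the bound can be
    used both at \<open>(real^3) set\<close> and at \<open>'b\<close>.\<close>
  have ge: "6 \<le> covering_type TYPE('c) real_projective_plane"
    unfolding covering_type_def strict_covering_type_def
    using good_cover_card_ge_6 by (auto intro!: Inf_greatest simp: numeral_eq_enat)
  \<comment> \<open>An upper estimate of the cardinality suffices, as the reverse inequality comes
    from \<open>ge\<close>.\<close>
  have "finite ico" "card ico \<le> 6"
    by (simp_all add: ico_def card_insert_le_m1)
  then have fin: "finite (cap ` ico)" and "card (cap ` ico) \<le> 6"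
    using card_image_le[of ico cap] by auto
  have "covering_type TYPE((real^3) set) real_projective_plane \<le> strict_covering_type real_projective_plane"
    unfolding covering_type_def by (intro Inf_lower) (auto intro: homotopy_equivalent_space_refl)
  also have "\<dots> \<le> enat (card (cap ` ico))"
    unfolding strict_covering_type_def using fin good_cover_caps by (intro Inf_lower) blast
  also have "\<dots> \<le> 6"
    using \<open>card (cap ` ico) \<le> 6\<close> by (simp add: numeral_eq_enat)
  finally show ?thesis
    using ge by (metis antisym)
qed

end
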